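(* Let $1\le l\le k$ be integers. In the $l$ vs $k$ game, the strategy profile $(o^{l,k},o^k)$, in which player 1 plays the mixed strategy $o^{l,k}$ and player 2 plays the pure strategy $o^k$, is a Nash equilibrium.
   Context: Customers are uniformly distributed on $[0,1]$. For integers $1\le l\le k$, the $l$ vs $k$ game is the following two-player game. Set $n_1=l$, $n_2=k$. The pure strategy set of player $i\in\{1,2\}$ is $S_i=\{(s_i^1,\dots,s_i^{n_i})\in[0,1]^{n_i}: s_i^1<\dots<s_i^{n_i}\}$; a pure strategy is identified with the set of its $n_i$ coordinates (facility locations). For a pure profile $\mathbf s=(s_1,s_2)$ and a customer $t\in[0,1]$, let $r_t(\mathbf s)=\{i\in\{1,2\}: \min_{f\in s_i}|t-f|\le \min_{f\in s_1\cup s_2}|t-f|\}$. The payoff is $u_i(\mathbf s)=\int_0^1 \frac{\mathbf 1[i\in r_t(\mathbf s)]}{|r_t(\mathbf s)|}\,dt$. $\Delta(S_i)$ is the set of Borel probability measures on $S_i$ (mixed strategies; a pure strategy is identified with its point mass), and $u_i(\mathbf x)=\mathbb E_{\mathbf s\sim\mathbf x}u_i(\mathbf s)$ for $\mathbf x=(x_1,x_2)\in\Delta(S_1)\times\Delta(S_2)$, with $s_1\sim x_1$, $s_2\sim x_2$ independent. A profile $(x_1,x_2)$ is a Nash equilibrium if no player can strictly increase her payoff by a unilateral change of mixed strategy. $k$-socially optimal locations: $o^k=\{o_1^k,\dots,o_k^k\}$ with $o_i^k=\frac{2i-1}{2k}$; note $o^k\in S_2$. The mixed strategy $o^{l,k}\in\Delta(S_1)$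 assigns probability $1/\binom{k}{l}$ to each subset of $o^k$ of size $l$. *)

theory Defs
  imports "HOL-Probability.Probability"
begin

definition pure_strategies :: "nat \<Rightarrow> (nat \<Rightarrow> real) set" where
  "pure_strategies n = {s \<in> {1..n} \<rightarrow>\<^sub>E {0..1}. strict_mono_on {1..n} s}"

definition locations :: "nat \<Rightarrow> (nat \<Rightarrow> real) \<Rightarrow> real set" where
  "locations n s = s ` {1..n}"

text \<open>
  The Borel \<open>\<sigma>\<close>-algebra on the pure strategies, as a subspace of \<open>\<real>\<^sup>n\<close>
  (points of \<open>\<real>\<^sup>n\<close> are the extensional functions on \<open>{1..n}\<close>).
\<close>

definition strategy_space :: "nat \<Rightarrow> (nat \<Rightarrow> real) measure" where
  "strategy_space n = restrict_space (PiM {1..n} (\<lambda>_. borel)) (pure_strategies n)"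

definition mixed_strategies :: "nat \<Rightarrow> (nat \<Rightarrow> real) measure set" where
  "mixed_strategies n = space (prob_algebra (strategy_space n))"

definition nearest_players :: "real set \<Rightarrow> real set \<Rightarrow> real \<Rightarrow> nat set" where
  "nearest_players A1 A2 t =
     {i \<in> {1, 2}. Min ((\<lambda>f. \<bar>t - f\<bar>) ` (if i = 1 then A1 else A2))
                   \<le> Min ((\<lambda>f. \<bar>t - f\<bar>) ` (A1 \<union> A2))}"

definition payoff :: "nat \<Rightarrow> real set \<Rightarrow> real set \<Rightarrow> real" where
  "payoff i A1 A2 =
     (LBINT t:{0..1}. indicator (nearest_players A1 A2 t) i / real (card (nearest_players A1 A2 t)))"

definition mixed_payoff ::
  "nat \<Rightarrow> nat \<Rightarrow> nat \<Rightarrow> (nat \<Rightarrow> real) measure \<Rightarrow> (nat \<Rightarrow> real) measure \<Rightarrow> real" where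
  "mixed_payoff l k i x1 x2 =
     (\<integral>s. payoff i (locations l (fst s)) (locations k (snd s)) \<partial>(x1 \<Otimes>\<^sub>M x2))"

definition nash_equilibrium ::
  "nat \<Rightarrow> nat \<Rightarrow> (nat \<Rightarrow> real) measure \<Rightarrow> (nat \<Rightarrow> real) measure \<Rightarrow> bool" where
  "nash_equilibrium l k x1 x2 \<longleftrightarrow>
     x1 \<in> mixed_strategies l \<and> x2 \<in> mixed_strategies k \<and>
     \<not> (\<exists>y1 \<in> mixed_strategies l. mixed_payoff l k 1 y1 x2 > mixed_payoff l k 1 x1 x2) \<and>
     \<not> (\<exists>y2 \<in> mixed_strategies k. mixed_payoff l k 2 x1 y2 > mixed_payoff l k 2 x1 x2)"

definition social_opt :: "nat \<Rightarrow> nat \<Rightarrow> real" where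
  "social_opt k = (\<lambda>i\<in>{1..k}. (2 * real i - 1) / (2 * real k))"

definition point_mass :: "nat \<Rightarrow> (nat \<Rightarrow> real) \<Rightarrow> (nat \<Rightarrow> real) measure" where
  "point_mass n s = return (strategy_space n) s"

text \<open>The pure strategy identified with a set of \<open>n\<close> locations, i.e. its increasing enumeration.\<close>

definition strategy_of_set :: "nat \<Rightarrow> real set \<Rightarrow> (nat \<Rightarrow> real)" where
  "strategy_of_set n A = (\<lambda>i\<in>{1..n}. sorted_list_of_set A ! (i - 1))"

definition random_social_opt :: "nat \<Rightarrow> nat \<Rightarrow> (nat \<Rightarrow> real) measure" where
  "random_social_opt l k =
     distr (uniform_count_measure {A. A \<subseteq> locations k (social_opt k) \<and> card A = l})
       (strategy_space l) (strategy_of_set l)"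

lemma locations_strategy_of_set:
  assumes "finite A" "card A = n"
  shows "locations n (strategy_of_set n A) = A"
proof -
  let ?xs = "sorted_list_of_set A"
  have "locations n (strategy_of_set n A) = (\<lambda>i. ?xs ! (i - 1)) ` {1..n}"
    by (auto simp: locations_def strategy_of_set_def)
  also have "{1..n} = Suc ` {0..<n}"
    by (simp add: atLeastLessThanSuc_atLeastAtMost)
  also have "(\<lambda>i. ?xs ! (i - 1)) ` Suc ` {0..<n} = (!) ?xs ` {0..<length ?xs}"
    using assms by (simp add: image_image del: image_Suc_atLeastLessThan)
  also have "\<dots> = set ?xs" by (auto simp only: set_conv_nth image_iff atLeastLessThan_iff mem_Collect_eq)
  finally show ?thesis using assms by simp
qed

lemma strategy_of_set_in_pure_strategies:
  assumes "finite A" "card A = n" "A \<subseteq> {0..1}"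
  shows "strategy_of_set n A \<in> pure_strategies n"
proof -
  have "strict_mono_on {1..n} (strategy_of_set n A)"
  proof (rule strict_mono_onI)
    fix r s assume "r \<in> {1..n}" "s \<in> {1..n}" "r < s"
    then show "strategy_of_set n A r < strategy_of_set n A s"
      using sorted_wrt_nth_less[OF strict_sorted_list_of_set[of A], of "r - 1" "s - 1"] assms
      by (simp add: strategy_of_set_def diff_less_mono)
  qed
  moreover have "strategy_of_set n A \<in> {1..n} \<rightarrow>\<^sub>E {0..1}"
  proof (rule PiE_I)
    fix i assume "i \<in> {1..n}"
    then show "strategy_of_set n A i \<in> {0..1}"
      using locations_strategy_of_set[OF assms(1,2)] assms(3) unfolding locations_def by blast
  qed (auto simp: strategy_of_set_def)
  ultimately show ?thesis by (simp add: pure_strategies_def)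
qed

lemma space_strategy_space: "space (strategy_space n) = pure_strategies n"
proof -
  have "pure_strategies n \<subseteq> space (PiM {1..n} (\<lambda>_. borel))"
    using PiE_mono[of "{1..n}" "\<lambda>_. {0..1}" "\<lambda>_. UNIV :: real set"]
    unfolding pure_strategies_def space_PiM space_borel by blast
  then show ?thesis unfolding strategy_space_def space_restrict_space by blast
qed

lemma social_opt_in_pure_strategies: "social_opt k \<in> pure_strategies k"
proof -
  have "social_opt k \<in> {1..k} \<rightarrow>\<^sub>E {0..1}"
    by (rule PiE_I) (auto simp: social_opt_def field_simps)
  moreover have "strict_mono_on {1..k} (social_opt k)"
    by (rule strict_mono_onI) (simp add: social_opt_def divide_strict_right_mono)
  ultimately show ?thesis by (simp add: pure_strategies_def)
qed

lemma card_locations_social_opt: "card (locations k (social_opt k)) = k"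
proof -
  have "inj_on (social_opt k) {1..k}"
    using social_opt_in_pure_strategies[of k] strict_mono_on_imp_inj_on
    unfolding pure_strategies_def by blast
  then show ?thesis by (simp add: locations_def card_image)
qed

lemma emeasure_random_social_opt:
  assumes "B \<in> sets (strategy_space l)"
  shows "emeasure (random_social_opt l k) B =
    real (card {A. A \<subseteq> locations k (social_opt k) \<and> card A = l \<and> strategy_of_set l A \<in> B}) /
    real (k choose l)"
proof -
  define S where "S = {A. A \<subseteq> locations k (social_opt k) \<and> card A = l}"
  have fin: "finite (locations k (social_opt k))" by (simp add: locations_def)
  have finS: "finite S"
    unfolding S_def by (rule finite_subset[OF _ finite_Pow_iff[THEN iffD2, OF fin]]) auto
  have cardS: "card S = k choose l"
    unfolding S_def using n_subsets[OF fin, of l] card_locations_social_opt[of k] by simp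
  have "locations k (social_opt k) \<subseteq> {0..1}"
    using social_opt_in_pure_strategies[of k]
    by (auto simp: locations_def pure_strategies_def PiE_iff)
  then have "strategy_of_set l A \<in> pure_strategies l" if "A \<in> S" for A
    using that finite_subset[OF _ fin] by (intro strategy_of_set_in_pure_strategies) (auto simp: S_def)
  then have meas: "strategy_of_set l \<in> measurable (uniform_count_measure S) (strategy_space l)"
    by (intro measurableI) (auto simp: space_uniform_count_measure sets_uniform_count_measure
        space_strategy_space)
  have "emeasure (random_social_opt l k) B =
      emeasure (uniform_count_measure S) {A \<in> S. strategy_of_set l A \<in> B}"
    unfolding random_social_opt_def S_def[symmetric] emeasure_distr[OF meas assms]
    by (rule arg_cong[where f = "emeasure _"]) (auto simp: space_uniform_count_measure)
  also have "\<dots> = real (card {A \<in> S. strategy_of_set l A \<in> B}) / real (card S)"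
    using finS by (subst emeasure_uniform_count_measure) auto
  finally show ?thesis unfolding cardS by (simp add: S_def)
qed

lemma random_social_opt_mixed:
  assumes "l \<le> k"
  shows "random_social_opt l k \<in> mixed_strategies l"
proof -
  have fin: "finite (locations k (social_opt k))" by (simp add: locations_def)
  have "locations k (social_opt k) \<subseteq> {0..1}"
    using social_opt_in_pure_strategies[of k]
    by (auto simp: locations_def pure_strategies_def PiE_iff)
  then have "strategy_of_set l A \<in> pure_strategies l"
    if "A \<subseteq> locations k (social_opt k)" "card A = l" for A
    using that finite_subset[OF that(1) fin] by (intro strategy_of_set_in_pure_strategies) auto
  then have "{A. A \<subseteq> locations k (social_opt k) \<and> card A = l \<and>
         strategy_of_set l A \<in> space (strategy_space l)} =
      {A. A \<subseteq> locations k (social_opt k) \<and> card A = l}"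
    unfolding space_strategy_space by blast
  moreover have "card \<dots> = k choose l"
    using n_subsets[of "locations k (social_opt k)" l] card_locations_social_opt[of k]
    by (simp add: locations_def)
  moreover have "k choose l > 0" using assms by simp
  ultimately have "emeasure (random_social_opt l k) (space (strategy_space l)) = 1"
    using emeasure_random_social_opt[OF sets.top, of l k] by simp
  moreover have "sets (random_social_opt l k) = sets (strategy_space l)"
    by (simp add: random_social_opt_def)
  ultimately show ?thesis
    unfolding mixed_strategies_def space_prob_algebra
    using sets_eq_imp_space_eq[of "random_social_opt l k" "strategy_space l"]
    by (simp add: prob_spaceI)
qed

lemma point_mass_mixed: "s \<in> pure_strategies n \<Longrightarrow> point_mass n s \<in> mixed_strategies n"
  by (simp add: mixed_strategies_def space_prob_algebra point_mass_def prob_space_return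
      space_strategy_space)

end

theory Submission
  imports Defs
begin

text \<open>
  The two payoffs sum to 1, so it suffices to show that \<open>l / 2k\<close> is a saddle value for player 1.
  Against \<open>o\<^sup>k\<close>, player 1's share is at most the sum of the shares that her locations would get
  individually, and a single location gets at most \<open>1 / 2k\<close>: half of a gap between consecutive
  optimal locations, or half of the length \<open>1 / k\<close> where it is tied. Conversely, let player 2 use
  any \<open>B\<close> with \<open>k\<close> locations. The optimal location nearest to a customer is in the random subset
  \<open>A\<close> with probability \<open>l / k\<close>, so the expected share of \<open>A\<close> is at least \<open>l / k\<close> times the share
  of \<open>o\<^sup>k\<close> against \<open>B\<close>, which is at least \<open>1 / 2\<close> by the first bound with the roles exchanged.
\<close>

section \<open>Shares of one location set against another\<close>

definition min_dist :: "real set \<Rightarrow> real \<Rightarrow> real" where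
  "min_dist A t = Min ((\<lambda>f. \<bar>t - f\<bar>) ` A)"

text \<open>The integrand of \<open>payoff\<close> for the owner of \<open>A\<close>. It carries no
  player index, so one bound can be applied with the roles exchanged.\<close>

definition win :: "real set \<Rightarrow> real set \<Rightarrow> real \<Rightarrow> real" where
  "win A B t =
     (if min_dist A t < min_dist B t then 1 else if min_dist A t = min_dist B t then 1 / 2 else 0)"

definition share :: "real set \<Rightarrow> real set \<Rightarrow> real" where
  "share A B = (LBINT t:{0..1}. win A B t)"

lemma win_nonneg: "0 \<le> win A B t"
  and win_le_1: "win A B t \<le> 1"
  and win_swap: "win A B t = 1 - win B A t"
  by (auto simp: win_def)

lemma set_integral_sum:
  fixes f :: "'i \<Rightarrow> 'a \<Rightarrow> 'b::{banach, second_countable_topology}"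
  assumes "\<And>i. i \<in> I \<Longrightarrow> set_integrable M S (f i)"
  shows "set_integrable M S (\<lambda>x. \<Sum>i\<in>I. f i x)"
    and "(LINT x:S|M. \<Sum>i\<in>I. f i x) = (\<Sum>i\<in>I. LINT x:S|M. f i x)"
  using assms unfolding set_integrable_def set_lebesgue_integral_def
  by (auto simp: scaleR_sum_right intro!: Bochner_Integration.integral_sum)

lemma min_dist_singleton [simp]: "min_dist {f} t = \<bar>t - f\<bar>"
  by (simp add: min_dist_def)

lemma min_dist_le: "finite A \<Longrightarrow> f \<in> A \<Longrightarrow> min_dist A t \<le> \<bar>t - f\<bar>"
  by (simp add: min_dist_def)

lemma min_dist_attained:
  assumes "finite A" "A \<noteq> {}"
  obtains f where "f \<in> A" "min_dist A t = \<bar>t - f\<bar>"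
proof -
  have "min_dist A t \<in> (\<lambda>f. \<bar>t - f\<bar>) ` A"
    unfolding min_dist_def using assms by (intro Min_in) auto
  then show thesis using that by blast
qed

lemma min_dist_Un:
  assumes "finite A" "A \<noteq> {}" "finite B" "B \<noteq> {}"
  shows "min_dist (A \<union> B) t = min (min_dist A t) (min_dist B t)"
  unfolding min_dist_def image_Un using assms by (intro Min_Un) auto

text \<open>By \<open>min_dist_Un\<close>, being nearest within the union only compares the two
  distances, which leaves three possible sets of nearest players.\<close>

lemma payoff_eq_share:
  assumes "finite A" "A \<noteq> {}" "finite B" "B \<noteq> {}"
  shows "payoff 1 A B = share A B" "payoff 2 A B = share B A"
proof -
  have np: "nearest_players A B t =
      (if min_dist A t < min_dist B t then {1} else if min_dist A t = min_dist B t then {1, 2} else {2})"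
    for t
    unfolding nearest_players_def min_dist_def[symmetric] min_dist_Un[OF assms] by auto
  have "indicator (nearest_players A B t) 1 / real (card (nearest_players A B t)) = win A B t"
    "indicator (nearest_players A B t) 2 / real (card (nearest_players A B t)) = win B A t" for t
    by (auto simp: np win_def)
  then show "payoff 1 A B = share A B" "payoff 2 A B = share B A"
    unfolding payoff_def share_def by simp_all
qed

text \<open>Locations are indexed families depending on a parameter, so the lemma covers both fixed
  sets with a varying customer and, in \<open>measurable_share\<close>, varying strategies.\<close>

lemma measurable_win:
  fixes f :: "'i \<Rightarrow> 'a \<Rightarrow> real" and g :: "'i \<Rightarrow> 'a \<Rightarrow> real" and h :: "'a \<Rightarrow> real"
  assumes "finite I" "finite J"
    and "\<And>i. i \<in> I \<Longrightarrow> f i \<in> borel_measurable M" "\<And>j. j \<in> J \<Longrightarrow> g j \<in> borel_measurable M"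
    and "h \<in> borel_measurable M"
  shows "(\<lambda>x. win ((\<lambda>i. f i x) ` I) ((\<lambda>j. g j x) ` J) (h x)) \<in> borel_measurable M"
proof -
  have *: "(\<lambda>x. min_dist ((\<lambda>i. f i x) ` I) (h x)) \<in> borel_measurable M"
    if "finite I" "\<And>i. i \<in> I \<Longrightarrow> f i \<in> borel_measurable M"
    for I :: "'i set" and f :: "'i \<Rightarrow> 'a \<Rightarrow> real"
    unfolding min_dist_def image_image using that assms(5)
    by (intro borel_measurable_Min borel_measurable_abs borel_measurable_diff) auto
  note [measurable] = *[OF assms(1,3)] *[OF assms(2,4)]
  show ?thesis unfolding win_def by measurable
qed

lemma set_integrable_win [intro]:
  assumes "finite A" "finite B"
  shows "set_integrable lborel {0..1} (win A B)"
proof -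
  have [measurable]: "win A B \<in> borel_measurable lborel"
    using measurable_win[OF assms, of "\<lambda>i x. i" lborel "\<lambda>i x. i" "\<lambda>x. x"] by simp
  show ?thesis
    unfolding set_integrable_def
    by (rule Bochner_Integration.integrable_bound[where f = "indicator {0..1} :: real \<Rightarrow> real"])
      (auto simp: indicator_def win_nonneg win_le_1)
qed

lemma share_nonneg: "0 \<le> share A B"
  unfolding share_def set_lebesgue_integral_def
  by (intro Bochner_Integration.integral_nonneg) (simp add: win_nonneg)

lemma share_swap:
  assumes "finite A" "finite B"
  shows "share A B = 1 - share B A"
proof -
  have "share A B = (LBINT t:{0..1}. 1 - win B A t)"
    unfolding share_def by (rule arg_cong[OF ext[OF win_swap]])
  also have "\<dots> = (LBINT t:{0..1::real}. 1) - share B A"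
    unfolding share_def
    by (intro set_integral_diff set_integrable_win assms) (simp add: set_integrable_def)
  finally show ?thesis by (simp add: set_lebesgue_integral_def)
qed

lemma share_le_1: "finite A \<Longrightarrow> finite B \<Longrightarrow> share A B \<le> 1"
  using share_swap[of A B] share_nonneg[of B A] by simp

text \<open>For each customer, a nearest location \<open>f\<close> of \<open>A\<close> alone
  achieves the same win as all of \<open>A\<close>, and the other summands are nonnegative.\<close>

lemma share_le_sum_singletons:
  assumes "finite A" "A \<noteq> {}" "finite B"
  shows "share A B \<le> (\<Sum>f\<in>A. share {f} B)"
proof -
  have "win A B t \<le> (\<Sum>f\<in>A. win {f} B t)" for t
  proof -
    obtain f where f: "f \<in> A" "min_dist A t = \<bar>t - f\<bar>" using min_dist_attained assms(1,2) .
    then have "win A B t = win {f} B t" by (simp add: win_def)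
    also have "\<dots> \<le> (\<Sum>f\<in>A. win {f} B t)"
      using f assms(1) by (intro member_le_sum) (auto simp: win_nonneg)
    finally show ?thesis .
  qed
  then have "share A B \<le> (LBINT t:{0..1}. \<Sum>f\<in>A. win {f} B t)"
    unfolding share_def using assms by (intro set_integral_mono set_integral_sum(1)) auto
  also have "\<dots> = (\<Sum>f\<in>A. share {f} B)"
    unfolding share_def using assms by (intro set_integral_sum(2)) auto
  finally show ?thesis .
qed

section \<open>Averaging over subsets of fixed size\<close>

lemma card_subsets_containing:
  assumes "finite X" "x \<in> X" "1 \<le> l"
  shows "card {A. A \<subseteq> X \<and> card A = l \<and> x \<in> A} = (card X - 1) choose (l - 1)"
proof -
  let ?T = "{A. A \<subseteq> X - {x} \<and> card A = l - 1}"
  have "bij_betw (insert x) ?T {A. A \<subseteq> X \<and> card A = l \<and> x \<in> A}"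
  proof (rule bij_betw_byWitness[where f' = "\<lambda>A. A - {x}"])
    show "insert x ` ?T \<subseteq> {A. A \<subseteq> X \<and> card A = l \<and> x \<in> A}"
    proof safe
      fix A assume A: "A \<subseteq> X - {x}" "card A = l - 1"
      then have "finite A" "x \<notin> A" using assms(1) finite_subset by auto
      then show "card (insert x A) = l" using A assms(3) by simp
    qed (use assms in auto)
  qed (use assms in \<open>auto simp: card_Diff_singleton\<close>)
  then have "card {A. A \<subseteq> X \<and> card A = l \<and> x \<in> A} = card ?T"
    using bij_betw_same_card by fastforce
  also have "\<dots> = (card X - 1) choose (l - 1)"
    using n_subsets[of "X - {x}" "l - 1"] assms by simp
  finally show ?thesis .
qed

text \<open>For a fixed customer, only the subsets containing a nearest point \<open>f\<close> of
  \<open>X\<close> are kept. Each of them is exactly as near as \<open>X\<close>, and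
  \<open>card_subsets_containing\<close> counts them.\<close>

lemma sum_share_subsets_ge:
  assumes "finite X" "X \<noteq> {}" "finite B" "1 \<le> l"
  shows "real ((card X - 1) choose (l - 1)) * share X B
    \<le> (\<Sum>A | A \<subseteq> X \<and> card A = l. share A B)"
proof -
  let ?S = "{A. A \<subseteq> X \<and> card A = l}"
  have fin: "finite ?S" by (rule finite_subset[of _ "Pow X"]) (use assms in auto)
  have finA: "finite A" if "A \<in> ?S" for A using that assms(1) finite_subset by blast
  have pointwise: "real ((card X - 1) choose (l - 1)) * win X B t \<le> (\<Sum>A\<in>?S. win A B t)" for t
  proof -
    obtain f where f: "f \<in> X" "min_dist X t = \<bar>t - f\<bar>" using min_dist_attained assms(1,2) .
    let ?T = "{A. A \<subseteq> X \<and> card A = l \<and> f \<in> A}"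
    have "win A B t = win X B t" if "A \<in> ?T" for A
    proof -
      have A: "finite A" "f \<in> A" "A \<subseteq> X" using that finA[of A] by simp_all
      obtain g where g: "g \<in> A" "min_dist A t = \<bar>t - g\<bar>" using min_dist_attained[of A t] A by blast
      have "min_dist X t \<le> min_dist A t" using g A min_dist_le[OF assms(1), of g t] by auto
      moreover have "min_dist A t \<le> min_dist X t" using min_dist_le[of A f t] A f by auto
      ultimately show ?thesis by (simp add: win_def)
    qed
    then have "real (card ?T) * win X B t = (\<Sum>A\<in>?T. win A B t)" by simp
    also have "\<dots> \<le> (\<Sum>A\<in>?S. win A B t)"
      using fin by (intro sum_mono2) (auto simp: win_nonneg)
    finally show ?thesis using card_subsets_containing[OF assms(1) f(1) assms(4)] by simp
  qed
  have "(LBINT t:{0..1}. real ((card X - 1) choose (l - 1)) * win X B t)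
      \<le> (LBINT t:{0..1}. \<Sum>A\<in>?S. win A B t)"
    by (intro set_integral_mono set_integral_sum(1) set_integrable_mult_right set_integrable_win
        finA assms pointwise)
  also have "\<dots> = (\<Sum>A\<in>?S. share A B)"
    unfolding share_def by (intro set_integral_sum(2) set_integrable_win finA assms)
  finally show ?thesis by (simp add: share_def)
qed

section \<open>Bounds involving the optimal locations\<close>

text \<open>Reduces a share bound to locating the customers served. The interval may extend beyond
  \<open>{0..1}\<close>, as happens when it is cut off by a virtual location; \<open>c\<close> is 1
  for outright wins and 1/2 for ties.\<close>

lemma share_le_of_support:
  assumes "finite A" "finite B" "0 \<le> c" "a \<le> b"
    and "\<And>t. t \<in> {0..1} \<Longrightarrow> win A B t \<le> c * indicator {a..b} t"
  shows "share A B \<le> c * (b - a)"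
proof -
  have "share A B \<le> (\<integral>t. c * indicator {a..b} t \<partial>lborel)"
    unfolding share_def set_lebesgue_integral_def
  proof (rule integral_mono)
    show "integrable lborel (\<lambda>t. indicator {0..1} t *\<^sub>R win A B t)"
      using set_integrable_win[OF assms(1,2)] by (simp add: set_integrable_def)
    show "integrable lborel (\<lambda>t. c * indicator {a..b} t)"
      by (intro integrable_mult_right integrable_real_indicator) (auto simp: assms)
    show "indicator {0..1} t *\<^sub>R win A B t \<le> c * indicator {a..b} t" for t
      using assms(3) assms(5)[of t] by (cases "t \<in> {0..1}") auto
  qed
  also have "\<dots> = c * (b - a)" using assms by simp
  finally show ?thesis .
qed

abbreviation (input) opt :: "nat \<Rightarrow> real set" where
  "opt k \<equiv> locations k (social_opt k)"

lemma opt_eq: "opt k = (\<lambda>i. (2 * real i - 1) / (2 * real k)) ` {1..k}"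
  by (auto simp: locations_def social_opt_def)

lemma finite_locations [simp]: "finite (locations n s)"
  by (simp add: locations_def)

lemma locations_nonempty [simp]: "1 \<le> n \<Longrightarrow> locations n s \<noteq> {}"
  by (simp add: locations_def)

text \<open>A customer served by \<open>f\<close> lies between the midpoints of \<open>f\<close>
  with its two neighbours. If \<open>f\<close> is strictly between neighbours, these are
  \<open>2 * h\<close> apart and the midpoints are \<open>h\<close> apart, wherever \<open>f\<close>
  sits. If \<open>f\<close> is itself optimal, the interval is twice as long, but every win there is
  a tie.\<close>

lemma share_singleton_opt_le:
  assumes k: "1 \<le> k" and f: "f \<in> {0..1}"
  shows "share {f} (opt k) \<le> 1 / (2 * real k)"
proof -
  define p where "p = (\<lambda>i::nat. (2 * real i - 1) / (2 * real k))"
  have fin: "finite (opt k)" by simp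
  have p_mem: "p i \<in> opt k" if "1 \<le> i" "i \<le> k" for i
    using that unfolding opt_eq p_def by (intro imageI) simp
  \<comment> \<open>Half the spacing of the optimal locations, also the distance from the outermost
    ones to the endpoints of \<open>{0..1}\<close>.\<close>
  define h where "h = 1 / (2 * real k)"
  have h_pos: "0 < h" using k by (simp add: h_def)
  have p_Suc: "p (Suc i) = p i + 2 * h" for i
    using k by (simp add: p_def h_def field_simps)
  have p_0: "p 0 = - h" and p_k: "p k = 1 - h"
    using k by (simp_all add: p_def h_def field_simps)
  \<comment> \<open>Reflecting the endpoints yields virtual locations \<open>p 0 < 0\<close> and \<open>p (k + 1) > 1\<close>, which never beat \<open>p 1\<close> and \<open>p k\<close>.\<close>
  have close: "\<bar>t - f\<bar> \<le> \<bar>t - p i\<bar>"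
    if t: "t \<in> {0..1}" and le: "\<bar>t - f\<bar> \<le> min_dist (opt k) t" and "i \<le> Suc k" for t i
  proof -
    have *: "\<bar>t - f\<bar> \<le> \<bar>t - p i\<bar>" if "1 \<le> i" "i \<le> k" for i
      using min_dist_le[OF fin p_mem[OF that], of t] le by simp
    consider "i = 0" | "1 \<le> i" "i \<le> k" | "i = Suc k" using \<open>i \<le> Suc k\<close> by linarith
    then show ?thesis
    proof cases
      case 1
      have "\<bar>t - f\<bar> \<le> \<bar>t - p 1\<bar>" using *[of 1] k by simp
      also have "\<dots> \<le> \<bar>t - p 0\<bar>"
        using t p_Suc[of 0] p_0 h_pos by (auto simp: abs_if)
      finally show ?thesis using 1 by simp
    next
      case 3
      have "\<bar>t - f\<bar> \<le> \<bar>t - p k\<bar>" using *[of k] k by simp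
      also have "\<dots> \<le> \<bar>t - p (Suc k)\<bar>"
        using t p_Suc[of k] p_k h_pos by (auto simp: abs_if)
      finally show ?thesis using 3 by simp
    qed (use * in blast)
  qed
  have near: "win {f} (opt k) t = 0 \<or> \<bar>t - f\<bar> \<le> min_dist (opt k) t" for t
    by (auto simp: win_def)
  \<comment> \<open>The largest index with \<open>p i \<le> f\<close>, obtained by solving this
    inequality for the index. It is 0 when \<open>f\<close> lies left of \<open>p 1\<close>, and
    \<open>k\<close> when \<open>f\<close> is at or right of \<open>p k\<close>.\<close>
  define i where "i = nat \<lfloor>real k * f + 1 / 2\<rfloor>"
  have "0 \<le> \<lfloor>real k * f + 1 / 2\<rfloor>" using f by simp
  then have "real i = of_int \<lfloor>real k * f + 1 / 2\<rfloor>" by (simp add: i_def)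
  then have i: "real i \<le> real k * f + 1 / 2" "real k * f + 1 / 2 < real i + 1"
    by linarith+
  have p_i: "p i \<le> f" "f < p (Suc i)" using i k by (simp_all add: p_def field_simps)
  have "real k * f \<le> real k" using f by (simp add: mult_left_le)
  then have "i \<le> k" using i by linarith
  show ?thesis
  proof (cases "f = p i")
    case True
    then have "i \<noteq> 0" using f p_0 h_pos by (intro notI) simp
    then obtain j where j: "i = Suc j" by (cases i) auto
    \<comment> \<open>The optimal set contains \<open>f\<close>, so it is never farther from
      \<open>t\<close> and \<open>f\<close> can at best tie.\<close>
    have tie: "win {f} (opt k) t \<le> 1 / 2" for t
    proof -
      have "f \<in> opt k" using p_mem[of i] True j \<open>i \<le> k\<close> by simp
      then show ?thesis using min_dist_le[OF fin, of f t] by (simp add: win_def)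
    qed
    have "share {f} (opt k) \<le> 1 / 2 * ((f + p (Suc i)) / 2 - (p j + f) / 2)"
    proof (rule share_le_of_support)
      fix t :: real assume t: "t \<in> {0..1}"
      show "win {f} (opt k) t \<le> 1 / 2 * indicator {(p j + f) / 2..(f + p (Suc i)) / 2} t"
      proof (cases "win {f} (opt k) t = 0")
        case False
        then have le: "\<bar>t - f\<bar> \<le> min_dist (opt k) t" using near by blast
        have "\<bar>t - f\<bar> \<le> \<bar>t - p j\<bar>" "\<bar>t - f\<bar> \<le> \<bar>t - p (Suc i)\<bar>"
          using close[OF t le] j \<open>i \<le> k\<close> by auto
        moreover have "p j < f" "f < p (Suc i)" using True j p_Suc[of j] p_i h_pos by simp_all
        ultimately have "t \<in> {(p j + f) / 2..(f + p (Suc i)) / 2}"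
          by (auto simp: abs_if split: if_splits)
        then show ?thesis using tie by simp
      qed simp
    qed (use True j p_Suc h_pos in auto)
    also have "\<dots> = 1 / (2 * real k)" using True j p_Suc by (simp add: h_def field_simps)
    finally show ?thesis .
  next
    case False
    have "share {f} (opt k) \<le> 1 * ((f + p (Suc i)) / 2 - (p i + f) / 2)"
    proof (rule share_le_of_support)
      fix t :: real assume t: "t \<in> {0..1}"
      show "win {f} (opt k) t \<le> 1 * indicator {(p i + f) / 2..(f + p (Suc i)) / 2} t"
      proof (cases "win {f} (opt k) t = 0")
        case nz: False
        then have le: "\<bar>t - f\<bar> \<le> min_dist (opt k) t" using near by blast
        have "\<bar>t - f\<bar> \<le> \<bar>t - p i\<bar>" "\<bar>t - f\<bar> \<le> \<bar>t - p (Suc i)\<bar>"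
          using close[OF t le] \<open>i \<le> k\<close> by auto
        moreover have "p i < f" "f < p (Suc i)" using False p_i by auto
        ultimately have "t \<in> {(p i + f) / 2..(f + p (Suc i)) / 2}"
          by (auto simp: abs_if split: if_splits)
        then show ?thesis by (simp add: win_le_1)
      qed simp
    qed (use p_i in auto)
    also have "\<dots> = 1 / (2 * real k)" using p_Suc by (simp add: h_def field_simps)
    finally show ?thesis .
  qed
qed

text \<open>Used twice: with \<open>l\<close> locations it limits the deviations of player 1, and
  with \<open>k\<close> locations it shows that no strategy of player 2 takes more than half against
  all of \<open>opt k\<close>.\<close>

lemma share_opt_le:
  assumes "1 \<le> k" "finite A" "A \<noteq> {}" "A \<subseteq> {0..1}"
  shows "share A (opt k) \<le> real (card A) / (2 * real k)"
proof -
  have "share A (opt k) \<le> (\<Sum>f\<in>A. share {f} (opt k))"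
    using assms by (intro share_le_sum_singletons) auto
  also have "\<dots> \<le> (\<Sum>f\<in>A. 1 / (2 * real k))"
    using assms by (intro sum_mono share_singleton_opt_le) auto
  finally show ?thesis by simp
qed

lemma pure_locations:
  assumes "s \<in> pure_strategies n"
  shows "locations n s \<subseteq> {0..1}" "card (locations n s) = n"
proof -
  show "locations n s \<subseteq> {0..1}"
    using assms by (auto simp: locations_def pure_strategies_def PiE_iff)
  have "inj_on s {1..n}"
    using assms strict_mono_on_imp_inj_on unfolding pure_strategies_def by blast
  then show "card (locations n s) = n" by (simp add: locations_def card_image)
qed

lemma average_share_subsets_opt_ge:
  assumes "1 \<le> l" "l \<le> k" "s \<in> pure_strategies k"
  shows "real l / (2 * real k) \<le>
    (\<Sum>A | A \<subseteq> opt k \<and> card A = l. share A (locations k s)) / real (k choose l)"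
proof -
  have k: "1 \<le> k" using assms by simp
  have "share (locations k s) (opt k) \<le> 1 / 2"
    using share_opt_le[of k "locations k s"] pure_locations[OF assms(3)] k by simp
  then have "1 / 2 \<le> share (opt k) (locations k s)"
    using share_swap[of "opt k" "locations k s"] by simp
  then have "real ((k - 1) choose (l - 1)) * (1 / 2)
      \<le> real ((k - 1) choose (l - 1)) * share (opt k) (locations k s)"
    by (intro mult_left_mono) auto
  also have "\<dots> \<le> (\<Sum>A | A \<subseteq> opt k \<and> card A = l. share A (locations k s))"
    using sum_share_subsets_ge[of "opt k" "locations k s" l] k assms(1)
    by (simp add: card_locations_social_opt)
  finally have le: "real ((k - 1) choose (l - 1)) / 2
      \<le> (\<Sum>A | A \<subseteq> opt k \<and> card A = l. share A (locations k s))" by simp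
  \<comment> \<open>Binomial absorption: a given optimal location belongs to a fraction
    \<open>l / k\<close> of the subsets of size \<open>l\<close>.\<close>
  have "l * (k choose l) = k * ((k - 1) choose (l - 1))"
    using assms k binomial_absorption[of "l - 1" k] by simp
  then have "real l * real (k choose l) = real k * real ((k - 1) choose (l - 1))"
    by (metis of_nat_mult)
  moreover have pos: "real (k choose l) > 0" using assms(2) by simp
  ultimately have "real l / (2 * real k) = real ((k - 1) choose (l - 1)) / 2 / real (k choose l)"
    using k by (simp add: field_simps)
  also have "\<dots> \<le> (\<Sum>A | A \<subseteq> opt k \<and> card A = l. share A (locations k s)) / real (k choose l)"
    using le pos by (intro divide_right_mono) auto
  finally show ?thesis .
qed

section \<open>Measurability and mixed payoffs\<close>

text \<open>The integrand is jointly measurable in both strategies and the customer, because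
  strategies enter only through their coordinates; integrating out the customer preserves
  measurability.\<close>

lemma measurable_share:
  "(\<lambda>s. share (locations l (fst s)) (locations k (snd s)))
     \<in> borel_measurable (strategy_space l \<Otimes>\<^sub>M strategy_space k)"
proof -
  let ?M = "(strategy_space l \<Otimes>\<^sub>M strategy_space k) \<Otimes>\<^sub>M lborel"
  have comp: "(\<lambda>s. s i) \<in> borel_measurable (strategy_space n)" if "i \<in> {1..n}" for i n
    unfolding strategy_space_def
    by (intro measurable_restrict_space1 measurable_component_singleton that)
  have 1: "(\<lambda>x. fst (fst x) i) \<in> borel_measurable ?M" if "i \<in> {1..l}" for i
    by (rule measurable_compose[OF _ comp[OF that]]) measurable
  have 2: "(\<lambda>x. snd (fst x) i) \<in> borel_measurable ?M" if "i \<in> {1..k}" for i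
    by (rule measurable_compose[OF _ comp[OF that]]) measurable
  have [measurable]: "(\<lambda>x. win (locations l (fst (fst x))) (locations k (snd (fst x))) (snd x))
      \<in> borel_measurable ?M"
    unfolding locations_def by (intro measurable_win 1 2) auto
  have "(\<lambda>(s, t). indicator {0..1::real} t *\<^sub>R win (locations l (fst s)) (locations k (snd s)) t)
      \<in> borel_measurable ?M"
    unfolding case_prod_unfold by measurable
  then show ?thesis
    unfolding share_def set_lebesgue_integral_def
    by (rule lborel.borel_measurable_lebesgue_integral)
qed

lemma mixed_strategiesD:
  assumes "x \<in> mixed_strategies n"
  shows "prob_space x" "sets x = sets (strategy_space n)" "space x = pure_strategies n"
  using assms sets_eq_imp_space_eq[of x "strategy_space n"]
  by (auto simp: mixed_strategies_def space_prob_algebra space_strategy_space)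

lemma integrable_share:
  assumes "x1 \<in> mixed_strategies l" "x2 \<in> mixed_strategies k"
  shows "integrable (x1 \<Otimes>\<^sub>M x2) (\<lambda>s. share (locations l (fst s)) (locations k (snd s)))"
proof -
  interpret x1: prob_space x1 using assms mixed_strategiesD by blast
  interpret x2: prob_space x2 using assms mixed_strategiesD by blast
  interpret P: pair_prob_space x1 x2 ..
  have "sets (x1 \<Otimes>\<^sub>M x2) = sets (strategy_space l \<Otimes>\<^sub>M strategy_space k)"
    using mixed_strategiesD assms by (intro sets_pair_measure_cong) auto
  then have "(\<lambda>s. share (locations l (fst s)) (locations k (snd s)))
      \<in> borel_measurable (x1 \<Otimes>\<^sub>M x2)"
    using measurable_share by (simp cong: measurable_cong_sets)
  then show ?thesis
    by (rule P.integrable_const_bound[where B = 1, rotated]) (simp add: share_nonneg share_le_1)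
qed

text \<open>Player 1's strategy is integrated first, since both bounds below are proved for a fixed
  pure strategy of player 2. The constant sum turns bounds on player 1's payoff into bounds on
  player 2's.\<close>

lemma mixed_payoff_eq:
  assumes "1 \<le> l" "1 \<le> k" "x1 \<in> mixed_strategies l" "x2 \<in> mixed_strategies k"
  shows "mixed_payoff l k 1 x1 x2 =
      (\<integral>s2. (\<integral>s1. share (locations l s1) (locations k s2) \<partial>x1) \<partial>x2)"
    and "mixed_payoff l k 2 x1 x2 = 1 - mixed_payoff l k 1 x1 x2"
proof -
  interpret x1: prob_space x1 using assms mixed_strategiesD by blast
  interpret x2: prob_space x2 using assms mixed_strategiesD by blast
  interpret P: pair_prob_space x1 x2 ..
  have 1: "mixed_payoff l k 1 x1 x2 =
      (\<integral>s. share (locations l (fst s)) (locations k (snd s)) \<partial>(x1 \<Otimes>\<^sub>M x2))"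
    unfolding mixed_payoff_def using assms by (simp add: payoff_eq_share(1)[unfolded One_nat_def])
  then show "mixed_payoff l k 1 x1 x2 =
      (\<integral>s2. (\<integral>s1. share (locations l s1) (locations k s2) \<partial>x1) \<partial>x2)"
    using P.integral_snd[of "\<lambda>s1 s2. share (locations l s1) (locations k s2)"]
      integrable_share[OF assms(3,4)] by (simp add: case_prod_unfold)
  have "mixed_payoff l k 2 x1 x2 =
      (\<integral>s. 1 - share (locations l (fst s)) (locations k (snd s)) \<partial>(x1 \<Otimes>\<^sub>M x2))"
    unfolding mixed_payoff_def using assms
    by (simp add: payoff_eq_share share_swap[of "locations k _" "locations l _"])
  also have "\<dots> = 1 - mixed_payoff l k 1 x1 x2"
    unfolding 1 using integrable_share[OF assms(3,4)]
    by (subst Bochner_Integration.integral_diff) (auto simp: P.prob_space)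
  finally show "mixed_payoff l k 2 x1 x2 = 1 - mixed_payoff l k 1 x1 x2" .
qed

lemma integrable_share_fst:
  assumes "x \<in> mixed_strategies l" "s \<in> pure_strategies k"
  shows "integrable x (\<lambda>s1. share (locations l s1) (locations k s))"
proof -
  interpret prob_space x using assms mixed_strategiesD by blast
  have "(\<lambda>s1. (s1, s)) \<in> measurable (strategy_space l) (strategy_space l \<Otimes>\<^sub>M strategy_space k)"
    using assms by (intro measurable_Pair2') (simp add: space_strategy_space)
  from measurable_compose[OF this measurable_share]
  have "(\<lambda>s1. share (locations l s1) (locations k s)) \<in> borel_measurable x"
    using mixed_strategiesD[OF assms(1)] by (simp cong: measurable_cong_sets)
  then show ?thesis
    by (rule integrable_const_bound[where B = 1, rotated]) (simp add: share_nonneg share_le_1)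
qed

text \<open>The uniform measure gives each subset the same weight, so the integral pulled back along
  \<open>strategy_of_set\<close> is a finite average.\<close>

lemma integral_random_social_opt:
  assumes "g \<in> borel_measurable (strategy_space l)"
  shows "(\<integral>s. g s \<partial>random_social_opt l k) =
    (\<Sum>A | A \<subseteq> opt k \<and> card A = l. g (strategy_of_set l A)) / real (k choose l)"
proof -
  let ?S = "{A. A \<subseteq> opt k \<and> card A = l}"
  have fin: "finite ?S" by (rule finite_subset[of _ "Pow (opt k)"]) auto
  have card: "card ?S = k choose l"
    using n_subsets[of "opt k" l] by (simp add: card_locations_social_opt)
  have "strategy_of_set l A \<in> pure_strategies l" if "A \<in> ?S" for A
    using that pure_locations(1)[OF social_opt_in_pure_strategies] finite_subset[of A "opt k"]
    by (intro strategy_of_set_in_pure_strategies) auto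
  then have "strategy_of_set l \<in> measurable (uniform_count_measure ?S) (strategy_space l)"
    by (intro measurableI)
      (auto simp: space_uniform_count_measure sets_uniform_count_measure space_strategy_space)
  then have "(\<integral>s. g s \<partial>random_social_opt l k) =
      (\<integral>A. g (strategy_of_set l A) \<partial>uniform_count_measure ?S)"
    unfolding random_social_opt_def using assms by (intro integral_distr)
  also have "\<dots> = (\<Sum>A\<in>?S. g (strategy_of_set l A)) / real (card ?S)"
    unfolding uniform_count_measure_def using fin
    by (subst lebesgue_integral_point_measure_finite) (auto simp: sum_divide_distrib)
  finally show ?thesis unfolding card .
qed

section \<open>The saddle value and the equilibrium\<close>

text \<open>The point mass evaluates the inner integral at \<open>social_opt k\<close>; there
  \<open>share_opt_le\<close> bounds the integrand for every pure strategy, hence its mean under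
  \<open>y\<close>.\<close>

lemma mixed_payoff_point_mass_le:
  assumes "1 \<le> l" "l \<le> k" "y \<in> mixed_strategies l"
  shows "mixed_payoff l k 1 y (point_mass k (social_opt k)) \<le> real l / (2 * real k)"
proof -
  interpret prob_space y using assms mixed_strategiesD by blast
  let ?g = "\<lambda>s2. \<integral>s1. share (locations l s1) (locations k s2) \<partial>y"
  \<comment> \<open>\<open>integral_return\<close> requires \<open>?g\<close> to be measurable. The
    pair is swapped because the variable to be integrated out must come second.\<close>
  have "(\<lambda>(s2, s1). share (locations l s1) (locations k s2))
      \<in> borel_measurable (strategy_space k \<Otimes>\<^sub>M y)"
  proof -
    have "sets (strategy_space k \<Otimes>\<^sub>M y) = sets (strategy_space k \<Otimes>\<^sub>M strategy_space l)"
      using mixed_strategiesD[OF assms(3)] by (intro sets_pair_measure_cong) auto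
    moreover have "(\<lambda>(s2, s1). share (locations l s1) (locations k s2))
        \<in> borel_measurable (strategy_space k \<Otimes>\<^sub>M strategy_space l)"
      using measurable_compose[OF measurable_pair_swap' measurable_share]
      by (simp add: case_prod_unfold)
    ultimately show ?thesis by (simp cong: measurable_cong_sets)
  qed
  then have "?g \<in> borel_measurable (strategy_space k)"
    by (rule borel_measurable_lebesgue_integral)
  then have "(\<integral>s2. ?g s2 \<partial>point_mass k (social_opt k)) = ?g (social_opt k)"
    unfolding point_mass_def using social_opt_in_pure_strategies[of k]
    by (intro integral_return) (auto simp: space_strategy_space)
  also have "\<dots> \<le> (\<integral>s1. real l / (2 * real k) \<partial>y)"
  proof (rule integral_mono)
    show "integrable y (\<lambda>s1. share (locations l s1) (opt k))"
      using assms social_opt_in_pure_strategies by (intro integrable_share_fst)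
    fix s assume "s \<in> space y"
    then have s: "s \<in> pure_strategies l" using mixed_strategiesD[OF assms(3)] by simp
    show "share (locations l s) (opt k) \<le> real l / (2 * real k)"
      using share_opt_le[of k "locations l s"] pure_locations[OF s] assms by simp
  qed simp
  finally show ?thesis
    using assms mixed_payoff_eq(1)[of l k y "point_mass k (social_opt k)"]
    by (simp add: point_mass_mixed social_opt_in_pure_strategies prob_space)
qed

text \<open>Against each pure strategy of player 2 the inner integral is the average bounded by
  \<open>average_share_subsets_opt_ge\<close>; integrating over \<open>y\<close> keeps the
  bound.\<close>

lemma mixed_payoff_random_social_opt_ge:
  assumes "1 \<le> l" "l \<le> k" "y \<in> mixed_strategies k"
  shows "real l / (2 * real k) \<le> mixed_payoff l k 1 (random_social_opt l k) y"
proof -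
  let ?x = "random_social_opt l k"
  have x: "?x \<in> mixed_strategies l" using assms by (intro random_social_opt_mixed)
  interpret x: prob_space ?x using x mixed_strategiesD by blast
  interpret y: prob_space y using assms mixed_strategiesD by blast
  interpret P: pair_prob_space ?x y ..
  have "(\<integral>s2. real l / (2 * real k) \<partial>y)
      \<le> (\<integral>s2. (\<integral>s1. share (locations l s1) (locations k s2) \<partial>?x) \<partial>y)"
  proof (rule integral_mono)
    show "integrable y (\<lambda>s2. \<integral>s1. share (locations l s1) (locations k s2) \<partial>?x)"
      using P.integrable_snd[of "\<lambda>s1 s2. share (locations l s1) (locations k s2)"]
        integrable_share[OF x assms(3)] by (simp add: case_prod_unfold)
    fix s assume "s \<in> space y"
    then have s: "s \<in> pure_strategies k" using mixed_strategiesD[OF assms(3)] by simp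
    have "(\<lambda>s1. share (locations l s1) (locations k s)) \<in> borel_measurable (strategy_space l)"
      using integrable_share_fst[OF x s] mixed_strategiesD[OF x]
      by (auto dest!: borel_measurable_integrable cong: measurable_cong_sets)
    then have "(\<integral>s1. share (locations l s1) (locations k s) \<partial>?x) =
        (\<Sum>A | A \<subseteq> opt k \<and> card A = l. share (locations l (strategy_of_set l A)) (locations k s))
          / real (k choose l)"
      by (rule integral_random_social_opt)
    also have "\<dots> = (\<Sum>A | A \<subseteq> opt k \<and> card A = l. share A (locations k s)) / real (k choose l)"
      using finite_subset[of _ "opt k"]
      by (intro arg_cong2[where f = "(/)"] sum.cong refl) (simp add: locations_strategy_of_set)
    finally show "real l / (2 * real k) \<le> (\<integral>s1. share (locations l s1) (locations k s) \<partial>?x)"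
      using average_share_subsets_opt_ge[OF assms(1,2) s] by simp
  qed simp
  then show ?thesis
    using assms x mixed_payoff_eq(1)[of l k ?x y] by (simp add: y.prob_space)
qed

theorem theorem1:
  fixes l k :: nat
  assumes "1 \<le> l" and "l \<le> k"
  shows "nash_equilibrium l k (random_social_opt l k) (point_mass k (social_opt k))"
proof -
  let ?x1 = "random_social_opt l k" and ?x2 = "point_mass k (social_opt k)"
  have x1: "?x1 \<in> mixed_strategies l" using assms by (intro random_social_opt_mixed)
  have x2: "?x2 \<in> mixed_strategies k"
    by (intro point_mass_mixed social_opt_in_pure_strategies)
  \<comment> \<open>The upper bound for the deviation and the lower bound for the profile meet at
    \<open>l / (2 * k)\<close>.\<close>
  have "mixed_payoff l k 1 y ?x2 \<le> mixed_payoff l k 1 ?x1 ?x2" if "y \<in> mixed_strategies l" for y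
    using mixed_payoff_point_mass_le[OF assms that] mixed_payoff_random_social_opt_ge[OF assms x2]
    by simp
  \<comment> \<open>Through the constant sum, the lower bound against \<open>y\<close> caps the
    deviation at \<open>1 - l / (2 * k)\<close>, while the upper bound with \<open>?x1\<close>
    guarantees that amount at the profile.\<close>
  moreover have "mixed_payoff l k 2 ?x1 y \<le> mixed_payoff l k 2 ?x1 ?x2"
    if "y \<in> mixed_strategies k" for y
    using mixed_payoff_point_mass_le[OF assms x1] mixed_payoff_random_social_opt_ge[OF assms that]
      mixed_payoff_eq(2)[of l k ?x1] x1 x2 that assms by simp
  ultimately show ?thesis unfolding nash_equilibrium_def using x1 x2 by (meson not_le)
qed

end
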